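(* Let $v\in S_n$ and let $A$ be any $p\times p$ ($p\ge 2$) minor of $Z^{(v)}$. Then $\det A$ is inhomogeneous if and only if $A$ contains at least one column of the form $(0,\dots,0,1,\dots,z,\dots)^t$, where $z\in\{z_{ij}\mid 1\le i\le n,\ 1\le j\le n\}$ is a variable entry of that column lying below the entry $1$, such that there exists a non zero path in $A$ which passes through $z$.
   Context: Rows of $n\times n$ matrices are numbered from bottom to top and columns from left to right. For $v\in S_n$, $Z^{(v)}$ is the $n\times n$ matrix whose entry in row $i$ (from the bottom) and column $j$ is: $1$ if $i=n-v(j)+1$; $0$ if $i>n-v(j)+1$; $0$ if $i=n-v(j')+1$ for some $j'<j$; and an indeterminate $z_{ij}$ otherwise (distinct positions carry distinct indeterminates). Thus each row and each column contains exactly one entry $1$, and all entries to the right of a $1$ in its row or above it in its column are $0$. A minor of $Z^{(v)}$ means a square submatrix, formed by some rows and the same number of columns, in the order they appear in $Z^{(v)}$. The superscript $t$ denotes transpose; columns are written from top to bottom, and the initial block of zeros may be empty. A path in a $q\times q$ matrix $[x_{ij}]$ is a set of entries $\{x_{i_11},x_{i_22},\dots,x_{i_qq}\}$, one from each column, with $i_1,\dots,i_q$ all distinct. A non zero path is a path containing no zero entry. A polynomial in the $z_{ij}$ is inhomogeneous if it is not homogeneous for the standard grading. *)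

theory Defs
  imports
    "HOL-Library.Poly_Mapping"
    "HOL-Combinatorics.Permutations"
    "Jordan_Normal_Form.Determinant"
    "Jordan_Normal_Form.DL_Submatrix"
begin

text \<open>A monomial is an exponent vector of finite support, and a polynomial is a finitely
  supported function from monomials to coefficients.\<close>

type_synonym 'x monomial = "'x \<Rightarrow>\<^sub>0 nat"
type_synonym ('x, 'a) mpolynomial = "'x monomial \<Rightarrow>\<^sub>0 'a"

definition indet :: "'x \<Rightarrow> ('x, 'a::zero_neq_one) mpolynomial" where
  "indet x = Poly_Mapping.single (Poly_Mapping.single x 1) 1"

definition monomial_degree :: "'x monomial \<Rightarrow> nat" where
  "monomial_degree m = (\<Sum>x\<in>Poly_Mapping.keys m. Poly_Mapping.lookup m x)"

text \<open>The zero polynomial is homogeneous.\<close>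

definition homogeneous :: "('x, 'a::zero) mpolynomial \<Rightarrow> bool" where
  "homogeneous f \<longleftrightarrow> (\<exists>d. \<forall>m\<in>Poly_Mapping.keys f. monomial_degree m = d)"

abbreviation inhomogeneous :: "('x, 'a::zero) mpolynomial \<Rightarrow> bool" where
  "inhomogeneous f \<equiv> \<not> homogeneous f"

text \<open>In \<open>Z_entry n v i j\<close> the indices are 1-based, with row \<open>i\<close> counted from the bottom.
  The matrix \<open>Z_mat n v\<close> has the library's 0-based indices, with row \<open>0\<close> on top, so its
  position \<open>(r, c)\<close> is row \<open>n - r\<close> from the bottom and column \<open>c + 1\<close>.\<close>

definition Z_entry ::
    "nat \<Rightarrow> (nat \<Rightarrow> nat) \<Rightarrow> nat \<Rightarrow> nat \<Rightarrow> (nat \<times> nat, 'a::comm_ring_1) mpolynomial" where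
  "Z_entry n v i j =
    (if i = n - v j + 1 then 1
     else if i > n - v j + 1 then 0
     else if \<exists>j'\<in>{1..<j}. i = n - v j' + 1 then 0
     else indet (i, j))"

definition Z_mat :: "nat \<Rightarrow> (nat \<Rightarrow> nat) \<Rightarrow> (nat \<times> nat, 'a::comm_ring_1) mpolynomial mat" where
  "Z_mat n v = mat n n (\<lambda>(r, c). Z_entry n v (n - r) (c + 1))"

definition is_minor :: "nat \<Rightarrow> 'b mat \<Rightarrow> 'b mat \<Rightarrow> bool" where
  "is_minor p A M \<longleftrightarrow>
    (\<exists>I J. I \<subseteq> {..<dim_row M} \<and> J \<subseteq> {..<dim_col M} \<and> card I = p \<and> card J = p \<and>
           A = submatrix M I J)"

text \<open>A path is represented by the set of positions of its entries, since distinct positions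
  may carry equal values.\<close>

definition is_path :: "nat \<Rightarrow> (nat \<times> nat) set \<Rightarrow> bool" where
  "is_path q P \<longleftrightarrow>
    (\<exists>f. f ` {..<q} \<subseteq> {..<q} \<and> inj_on f {..<q} \<and> P = (\<lambda>c. (f c, c)) ` {..<q})"

definition nonzero_path :: "nat \<Rightarrow> 'b::zero mat \<Rightarrow> (nat \<times> nat) set \<Rightarrow> bool" where
  "nonzero_path q A P \<longleftrightarrow> is_path q P \<and> (\<forall>(r, c)\<in>P. A $$ (r, c) \<noteq> 0)"

text \<open>Column \<open>c\<close> of the \<open>p \<times> p\<close> matrix \<open>A\<close> reads \<open>(0,\<dots>,0,1,\<dots>,z,\<dots>)\<^sup>t\<close> from top to bottom,
  where \<open>z\<close> is an indeterminate \<open>z\<^sub>i\<^sub>j\<close> standing in row \<open>r\<close>, below the entry \<open>1\<close> in row \<open>s\<close>.\<close>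

definition column_with_variable_below_one ::
    "nat \<Rightarrow> nat \<Rightarrow> (nat \<times> nat, 'a::comm_ring_1) mpolynomial mat \<Rightarrow> nat \<Rightarrow> nat \<Rightarrow> bool" where
  "column_with_variable_below_one n p A c r \<longleftrightarrow>
    (\<exists>s. s < r \<and> r < p \<and> (\<forall>k<s. A $$ (k, c) = 0) \<and> A $$ (s, c) = 1 \<and>
         A $$ (r, c) \<in> {indet (i, j) | i j. 1 \<le> i \<and> i \<le> n \<and> 1 \<le> j \<and> j \<le> n})"

end

theory Submission
  imports Defs
begin

text \<open>The Leibniz expansion of \<open>det A\<close> is a sum over the nonzero paths of \<open>A\<close>, and no two of its
  terms cancel: the indeterminates in a path's monomial reveal the positions that the path
  visits outside the entries \<open>1\<close>, and in each remaining column the path must take the unique \<open>1\<close>.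
  So the monomials of \<open>det A\<close> correspond to the nonzero paths, with coefficients \<open>1\<close> or \<open>-1\<close>
  (lemma \<open>keys_det\<close>), and \<open>det A\<close> is homogeneous exactly when all nonzero paths contain the same
  number of indeterminates (\<open>homogeneous_det_iff\<close>).

  If two nonzero paths contain different numbers of indeterminates, there is a column in which
  the one with fewer of them takes the entry \<open>1\<close> and the other one an indeterminate. Everything
  above a \<open>1\<close> vanishes, so the indeterminate lies below the \<open>1\<close>.

  Conversely, let a nonzero path go through an indeterminate in position \<open>(r, c)\<close> below an entry
  \<open>1\<close> in position \<open>(s, c)\<close>. The path meets row \<open>s\<close> in another column \<open>d\<close>. Since everything to the
  right of a \<open>1\<close> vanishes, \<open>d < c\<close>, and \<open>(s, d)\<close> carries an indeterminate, which lies below the \<open>1\<close>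
  that its column has in \<open>Z\<^sup>(\<^sup>v\<^sup>)\<close>. The entry \<open>(r, d)\<close> is then an indeterminate too: it is even
  further below that \<open>1\<close>, and a \<open>1\<close> to its left in \<open>Z\<^sup>(\<^sup>v\<^sup>)\<close> would make \<open>(r, c)\<close> zero. Replacing
  \<open>(r, c)\<close> and \<open>(s, d)\<close> by \<open>(s, c)\<close> and \<open>(r, d)\<close> therefore gives a nonzero path with exactly one
  indeterminate fewer (\<open>transposed_path\<close>).\<close>

section \<open>Products of indeterminates\<close>

lemma indet_neq:
  shows "indet x \<noteq> (0 :: ('x, 'a::comm_ring_1) mpolynomial)"
    and "indet x \<noteq> (1 :: ('x, 'a::comm_ring_1) mpolynomial)"
proof -
  have lk: "Poly_Mapping.lookup (indet x :: ('x, 'a) mpolynomial) (Poly_Mapping.single x 1) = 1"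
    by (simp add: indet_def)
  show "indet x \<noteq> (0 :: ('x, 'a) mpolynomial)"
    using lk by (metis lookup_zero zero_neq_one)
  have "Poly_Mapping.single x (1::nat) \<noteq> 0"
    by (metis lookup_single_eq lookup_zero zero_neq_one)
  then have "Poly_Mapping.lookup (1 :: ('x, 'a) mpolynomial) (Poly_Mapping.single x 1) = 0"
    by (simp add: lookup_one)
  then show "indet x \<noteq> (1 :: ('x, 'a) mpolynomial)"
    using lk by (metis zero_neq_one)
qed

lemma lookup_squarefree_monomial:
  assumes "finite S" "inj_on g S"
  shows "Poly_Mapping.lookup (\<Sum>c\<in>S. Poly_Mapping.single (g c) (1::nat)) y
    = (if y \<in> g ` S then 1 else 0)"
proof -
  have "Poly_Mapping.lookup (\<Sum>c\<in>S. Poly_Mapping.single (g c) (1::nat)) y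
      = (\<Sum>c\<in>S. if g c = y then 1 else 0)"
    by (simp add: lookup_sum lookup_single when_def del: One_nat_def)
  also have "\<dots> = (\<Sum>z\<in>g ` S. if z = y then 1 else 0)"
    using assms(2) by (simp add: sum.reindex del: One_nat_def)
  also have "\<dots> = (if y \<in> g ` S then 1 else 0)"
    using assms(1) by (simp add: sum.delta')
  finally show ?thesis .
qed

lemma keys_squarefree_monomial:
  assumes "finite S" "inj_on g S"
  shows "Poly_Mapping.keys (\<Sum>c\<in>S. Poly_Mapping.single (g c) (1::nat)) = g ` S"
  by (auto simp: in_keys_iff lookup_squarefree_monomial[OF assms] simp del: One_nat_def split: if_splits)

lemma degree_squarefree_monomial:
  assumes "finite S" "inj_on g S"
  shows "monomial_degree (\<Sum>c\<in>S. Poly_Mapping.single (g c) (1::nat)) = card S"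
  unfolding monomial_degree_def
  by (simp add: keys_squarefree_monomial[OF assms] lookup_squarefree_monomial[OF assms]
      card_image[OF assms(2)] del: One_nat_def)

lemma prod_indets:
  assumes "finite S"
  shows "(\<Prod>c\<in>S. (indet (g c) :: ('x, 'a::comm_ring_1) mpolynomial))
    = Poly_Mapping.single (\<Sum>c\<in>S. Poly_Mapping.single (g c) 1) 1"
  using assms by (induction S rule: finite_induct) (simp_all add: indet_def mult_single)

section \<open>Determinants of matrices with entries zero, one and distinct indeterminates\<close>

text \<open>These are the properties of \<open>Z\<^sup>(\<^sup>v\<^sup>)\<close> that every minor inherits and that the argument uses;
  row \<open>0\<close> is the top row. A minor may lose the \<open>1\<close> of column \<open>d\<close> that forces \<open>exchange\<close>, so
  \<open>exchange\<close> is recorded as a property of the entries at the four corners of the exchange alone.\<close>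
locale staircase_matrix =
  fixes A :: "('x, 'a::comm_ring_1) mpolynomial mat" and p :: nat and x :: "nat \<times> nat \<Rightarrow> 'x"
  assumes square: "A \<in> carrier_mat p p"
    and entry: "\<And>r c. r < p \<Longrightarrow> c < p \<Longrightarrow> A $$ (r, c) \<in> {0, 1, indet (x (r, c))}"
    and inj_labels: "inj_on x ({..<p} \<times> {..<p})"
    and zero_above_one:
      "\<And>k s c. s < p \<Longrightarrow> c < p \<Longrightarrow> A $$ (s, c) = 1 \<Longrightarrow> k < s \<Longrightarrow> A $$ (k, c) = 0"
    and exchange:
      "\<And>r s c d. r < p \<Longrightarrow> s < p \<Longrightarrow> c < p \<Longrightarrow> d < p \<Longrightarrow> d \<noteq> c \<Longrightarrow> s < r \<Longrightarrow>
        A $$ (s, c) = 1 \<Longrightarrow> A $$ (r, c) \<noteq> 0 \<Longrightarrow> A $$ (s, d) \<noteq> 0 \<Longrightarrow>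
        A $$ (s, d) \<noteq> 1 \<and> A $$ (r, d) \<notin> {0, 1}"
begin

text \<open>A permutation \<open>\<sigma>\<close> stands for the path through the positions \<open>(\<sigma> c, c)\<close>.\<close>
definition nonzero_perms :: "(nat \<Rightarrow> nat) set" where
  "nonzero_perms = {\<sigma>. \<sigma> permutes {0..<p} \<and> (\<forall>c<p. A $$ (\<sigma> c, c) \<noteq> 0)}"

definition var_cols :: "(nat \<Rightarrow> nat) \<Rightarrow> nat set" where
  "var_cols \<sigma> = {c. c < p \<and> A $$ (\<sigma> c, c) \<noteq> 1}"

definition path_monomial :: "(nat \<Rightarrow> nat) \<Rightarrow> 'x monomial" where
  "path_monomial \<sigma> = (\<Sum>c\<in>var_cols \<sigma>. Poly_Mapping.single (x (\<sigma> c, c)) 1)"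

lemma nonzero_permsD:
  assumes "\<sigma> \<in> nonzero_perms"
  shows "\<sigma> permutes {0..<p}" "\<And>c. c < p \<Longrightarrow> A $$ (\<sigma> c, c) \<noteq> 0" "\<And>c. c < p \<Longrightarrow> \<sigma> c < p"
  using assms permutes_in_image[of \<sigma> "{0..<p}"] by (auto simp: nonzero_perms_def)

lemma finite_var_cols: "finite (var_cols \<sigma>)"
  by (simp add: var_cols_def)

lemma inj_on_path_labels:
  assumes "\<sigma> \<in> nonzero_perms"
  shows "inj_on (\<lambda>c. x (\<sigma> c, c)) (var_cols \<sigma>)"
  using inj_labels nonzero_permsD(3)[OF assms]
  by (auto simp: inj_on_def var_cols_def)

lemma keys_path_monomial:
  assumes "\<sigma> \<in> nonzero_perms"
  shows "Poly_Mapping.keys (path_monomial \<sigma>) = (\<lambda>c. x (\<sigma> c, c)) ` var_cols \<sigma>"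
  unfolding path_monomial_def
  by (rule keys_squarefree_monomial[OF finite_var_cols inj_on_path_labels[OF assms]])

lemma degree_path_monomial:
  assumes "\<sigma> \<in> nonzero_perms"
  shows "monomial_degree (path_monomial \<sigma>) = card (var_cols \<sigma>)"
  unfolding path_monomial_def
  by (rule degree_squarefree_monomial[OF finite_var_cols inj_on_path_labels[OF assms]])

lemma one_unique_in_column:
  assumes "r < p" "s < p" "c < p" "A $$ (r, c) = 1" "A $$ (s, c) = 1"
  shows "r = s"
  using zero_above_one[of r c s] zero_above_one[of s c r] assms
  by (metis linorder_neqE_nat zero_neq_one)

text \<open>Labels are distinct, so the indeterminates of a monomial tell where the path runs in
  the columns in which it avoids \<open>1\<close>.\<close>
lemma path_monomial_cols:
  assumes \<sigma>: "\<sigma> \<in> nonzero_perms" and \<tau>: "\<tau> \<in> nonzero_perms"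
    and eq: "path_monomial \<sigma> = path_monomial \<tau>" and c: "c \<in> var_cols \<sigma>"
  shows "c \<in> var_cols \<tau> \<and> \<sigma> c = \<tau> c"
proof -
  have "x (\<sigma> c, c) \<in> (\<lambda>c. x (\<tau> c, c)) ` var_cols \<tau>"
    using c eq keys_path_monomial[OF \<sigma>] keys_path_monomial[OF \<tau>] by auto
  then obtain d where d: "d \<in> var_cols \<tau>" "x (\<sigma> c, c) = x (\<tau> d, d)" by auto
  have "(\<sigma> c, c) = (\<tau> d, d)"
    using inj_onD[OF inj_labels d(2)] c d(1) nonzero_permsD(3)[OF \<sigma>] nonzero_permsD(3)[OF \<tau>]
    by (auto simp: var_cols_def)
  with d(1) show ?thesis by auto
qed

text \<open>The monomial fixes the path on its indeterminates; in every other column both paths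
  take the only \<open>1\<close> there.\<close>
lemma inj_on_path_monomial: "inj_on path_monomial nonzero_perms"
proof (rule inj_onI)
  fix \<sigma> \<tau> assume \<sigma>: "\<sigma> \<in> nonzero_perms" and \<tau>: "\<tau> \<in> nonzero_perms"
    and eq: "path_monomial \<sigma> = path_monomial \<tau>"
  have "\<sigma> c = \<tau> c" for c
  proof (cases "c < p")
    case False
    then show ?thesis
      using permutes_not_in[OF nonzero_permsD(1)[OF \<sigma>]] permutes_not_in[OF nonzero_permsD(1)[OF \<tau>]]
      by simp
  next
    case True
    show ?thesis
    proof (cases "c \<in> var_cols \<sigma> \<or> c \<in> var_cols \<tau>")
      case True
      then show ?thesis
        using path_monomial_cols[OF \<sigma> \<tau> eq] path_monomial_cols[OF \<tau> \<sigma> eq[symmetric]] by metis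
    next
      case False
      with \<open>c < p\<close> have "A $$ (\<sigma> c, c) = 1" "A $$ (\<tau> c, c) = 1" by (auto simp: var_cols_def)
      then show ?thesis
        using one_unique_in_column nonzero_permsD(3)[OF \<sigma>] nonzero_permsD(3)[OF \<tau>] \<open>c < p\<close> by blast
    qed
  qed
  then show "\<sigma> = \<tau>" by blast
qed

lemma path_product:
  assumes \<sigma>: "\<sigma> \<in> nonzero_perms"
  shows "(\<Prod>c<p. A $$ (\<sigma> c, c)) = Poly_Mapping.single (path_monomial \<sigma>) 1"
proof -
  have "(\<Prod>c<p. A $$ (\<sigma> c, c)) = (\<Prod>c\<in>var_cols \<sigma>. A $$ (\<sigma> c, c))"
    by (rule prod.mono_neutral_right) (auto simp: var_cols_def)
  also have "\<dots> = (\<Prod>c\<in>var_cols \<sigma>. indet (x (\<sigma> c, c)))"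
    using entry nonzero_permsD[OF \<sigma>] by (intro prod.cong) (fastforce simp: var_cols_def)+
  also have "\<dots> = Poly_Mapping.single (path_monomial \<sigma>) 1"
    unfolding path_monomial_def by (rule prod_indets[OF finite_var_cols])
  finally show ?thesis .
qed

lemma det_as_sum_of_paths:
  "det A = (\<Sum>\<sigma>\<in>nonzero_perms. Poly_Mapping.single (path_monomial \<sigma>) (signof \<sigma>))"
proof -
  have "det A = (\<Sum>\<sigma> | \<sigma> permutes {0..<p}. signof \<sigma> * (\<Prod>c<p. A $$ (\<sigma> c, c)))"
    by (rule det_col[OF square])
  also have "\<dots> = (\<Sum>\<sigma>\<in>nonzero_perms. signof \<sigma> * (\<Prod>c<p. A $$ (\<sigma> c, c)))"
  proof (rule sum.mono_neutral_right)
    show "\<forall>\<sigma>\<in>{\<sigma>. \<sigma> permutes {0..<p}} - nonzero_perms.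
        signof \<sigma> * (\<Prod>c<p. A $$ (\<sigma> c, c)) = 0"
    proof
      fix \<sigma> assume "\<sigma> \<in> {\<sigma>. \<sigma> permutes {0..<p}} - nonzero_perms"
      then have "\<exists>c\<in>{..<p}. A $$ (\<sigma> c, c) = 0" by (auto simp: nonzero_perms_def)
      then have "(\<Prod>c<p. A $$ (\<sigma> c, c)) = 0" by (intro prod_zero) auto
      then show "signof \<sigma> * (\<Prod>c<p. A $$ (\<sigma> c, c)) = 0" by simp
    qed
  qed (auto simp: nonzero_perms_def finite_permutations)
  also have "\<dots> = (\<Sum>\<sigma>\<in>nonzero_perms. Poly_Mapping.single (path_monomial \<sigma>) (signof \<sigma>))"
  proof (rule sum.cong[OF refl])
    fix \<sigma> assume "\<sigma> \<in> nonzero_perms"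
    show "signof \<sigma> * (\<Prod>c<p. A $$ (\<sigma> c, c))
        = Poly_Mapping.single (path_monomial \<sigma>) (signof \<sigma>)"
      by (simp add: path_product[OF \<open>\<sigma> \<in> nonzero_perms\<close>] sign_def single_uminus)
  qed
  finally show ?thesis .
qed

text \<open>By injectivity each coefficient of the determinant comes from at most one path, and it is
  the sign of that path, a unit and hence nonzero in any coefficient ring with \<open>0 \<noteq> 1\<close>.\<close>
lemma keys_det: "Poly_Mapping.keys (det A) = path_monomial ` nonzero_perms"
proof -
  have fin: "finite nonzero_perms"
    by (rule finite_subset[OF _ finite_permutations[of "{0..<p}"]]) (auto simp: nonzero_perms_def)
  have lk: "Poly_Mapping.lookup (det A) m
      = (\<Sum>\<sigma>\<in>nonzero_perms. if path_monomial \<sigma> = m then signof \<sigma> else 0)" for m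
    by (simp add: det_as_sum_of_paths lookup_sum lookup_single when_def)
  show ?thesis
  proof (intro equalityI subsetI)
    fix m assume "m \<in> Poly_Mapping.keys (det A)"
    then have "\<exists>\<sigma>\<in>nonzero_perms. (if path_monomial \<sigma> = m then signof \<sigma> else (0 :: 'a)) \<noteq> 0"
      unfolding in_keys_iff lk using sum.not_neutral_contains_not_neutral by blast
    then show "m \<in> path_monomial ` nonzero_perms"
      by (auto split: if_splits)
  next
    fix m assume "m \<in> path_monomial ` nonzero_perms"
    then obtain \<tau> where \<tau>: "\<tau> \<in> nonzero_perms" "m = path_monomial \<tau>" by blast
    have "Poly_Mapping.lookup (det A) m
        = (\<Sum>\<sigma>\<in>nonzero_perms. if \<sigma> = \<tau> then signof \<sigma> else 0)"
      unfolding lk \<tau>(2) using inj_on_path_monomial \<tau>(1)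
      by (intro sum.cong) (auto dest: inj_onD)
    also have "\<dots> = signof \<tau>" using fin \<tau>(1) by simp
    finally show "m \<in> Poly_Mapping.keys (det A)" by (simp add: in_keys_iff sign_def)
  qed
qed

lemma homogeneous_det_iff:
  "homogeneous (det A)
    \<longleftrightarrow> (\<forall>\<sigma>\<in>nonzero_perms. \<forall>\<tau>\<in>nonzero_perms. card (var_cols \<sigma>) = card (var_cols \<tau>))"
proof -
  have "homogeneous (det A) \<longleftrightarrow> (\<exists>d. \<forall>\<sigma>\<in>nonzero_perms. card (var_cols \<sigma>) = d)"
    unfolding homogeneous_def keys_det by (simp add: degree_path_monomial)
  then show ?thesis by metis
qed

text \<open>Exchanging the rows of column \<open>c\<close> and of the column in which the path meets row \<open>s\<close>
  trades one indeterminate for a \<open>1\<close> and keeps the path nonzero.\<close>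
lemma transposed_path:
  assumes \<sigma>: "\<sigma> \<in> nonzero_perms" and c: "c < p" and s: "s < \<sigma> c" and one: "A $$ (s, c) = 1"
  obtains \<tau> where "\<tau> \<in> nonzero_perms" "var_cols \<tau> = var_cols \<sigma> - {c}" "c \<in> var_cols \<sigma>"
proof -
  note perm = nonzero_permsD(1)[OF \<sigma>] and nz = nonzero_permsD(2)[OF \<sigma>]
    and bound = nonzero_permsD(3)[OF \<sigma>]
  have sp: "s < p" using s bound[OF c] by simp
  obtain d where d: "d < p" and \<sigma>d: "\<sigma> d = s"
    using permutes_image[OF perm] sp by (metis atLeast0LessThan imageE lessThan_iff)
  have dc: "d \<noteq> c" using \<sigma>d s by auto
  have ex: "A $$ (s, d) \<noteq> 1" "A $$ (\<sigma> c, d) \<noteq> 0" "A $$ (\<sigma> c, d) \<noteq> 1"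
    using exchange[OF bound[OF c] sp c d dc s one nz[OF c]] nz[OF d] \<sigma>d by auto
  define \<tau> where "\<tau> = \<sigma> \<circ> transpose c d"
  have \<tau>: "\<tau> c = s" "\<tau> d = \<sigma> c" "\<And>e. e \<noteq> c \<Longrightarrow> e \<noteq> d \<Longrightarrow> \<tau> e = \<sigma> e"
    using \<sigma>d by (auto simp: \<tau>_def transpose_def)
  have "\<tau> permutes {0..<p}"
    unfolding \<tau>_def using c d by (intro permutes_compose[OF permutes_swap_id perm]) auto
  moreover have "A $$ (\<tau> e, e) \<noteq> 0" if "e < p" for e
    using \<tau> ex one nz[OF that] by (cases "e = c"; cases "e = d") auto
  ultimately have "\<tau> \<in> nonzero_perms" by (simp add: nonzero_perms_def)
  moreover have "var_cols \<tau> = var_cols \<sigma> - {c}"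
  proof (rule Set.set_eqI)
    fix e show "e \<in> var_cols \<tau> \<longleftrightarrow> e \<in> var_cols \<sigma> - {c}"
      using \<tau> \<sigma>d ex one d by (cases "e = c"; cases "e = d") (auto simp: var_cols_def)
  qed
  moreover have "c \<in> var_cols \<sigma>"
    using one_unique_in_column[OF bound[OF c] sp c _ one] s c by (auto simp: var_cols_def)
  ultimately show ?thesis using that by blast
qed

text \<open>Two paths of different degree disagree in a column where the one of lower degree takes
  the \<open>1\<close>, and the other one must run below it. Conversely, the exchange lowers the degree by one.\<close>
lemma inhomogeneous_det_iff:
  "inhomogeneous (det A)
    \<longleftrightarrow> (\<exists>\<sigma>\<in>nonzero_perms. \<exists>c<p. \<exists>s<\<sigma> c. A $$ (s, c) = 1)"
proof
  assume "inhomogeneous (det A)"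
  then obtain \<sigma> \<tau> where \<sigma>: "\<sigma> \<in> nonzero_perms" and \<tau>: "\<tau> \<in> nonzero_perms"
    and less: "card (var_cols \<tau>) < card (var_cols \<sigma>)"
    unfolding homogeneous_det_iff by (metis linorder_neqE_nat)
  then obtain c where "c \<in> var_cols \<sigma>" "c \<notin> var_cols \<tau>"
    using card_mono[OF finite_var_cols, of "var_cols \<sigma>" \<tau>] by fastforce
  then have c: "c < p" and one: "A $$ (\<tau> c, c) = 1" and not_one: "A $$ (\<sigma> c, c) \<noteq> 1"
    by (auto simp: var_cols_def)
  have "\<not> \<sigma> c < \<tau> c"
    using zero_above_one[OF nonzero_permsD(3)[OF \<tau> c] c one] nonzero_permsD(2)[OF \<sigma> c] by blast
  moreover have "\<sigma> c \<noteq> \<tau> c" using one not_one by metis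
  ultimately have "\<tau> c < \<sigma> c" by simp
  then show "\<exists>\<sigma>\<in>nonzero_perms. \<exists>c<p. \<exists>s<\<sigma> c. A $$ (s, c) = 1"
    using \<sigma> c one by blast
next
  assume "\<exists>\<sigma>\<in>nonzero_perms. \<exists>c<p. \<exists>s<\<sigma> c. A $$ (s, c) = 1"
  then obtain \<sigma> c s where \<sigma>: "\<sigma> \<in> nonzero_perms" and "c < p" "s < \<sigma> c" "A $$ (s, c) = 1"
    by blast
  then obtain \<tau> where \<tau>: "\<tau> \<in> nonzero_perms" "var_cols \<tau> = var_cols \<sigma> - {c}" "c \<in> var_cols \<sigma>"
    by (rule transposed_path)
  then have "card (var_cols \<tau>) < card (var_cols \<sigma>)"
    by (metis card_Diff1_less finite_var_cols)
  then show "inhomogeneous (det A)"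
    unfolding homogeneous_det_iff using \<sigma> \<tau>(1) by (metis less_irrefl)
qed

lemma nonzero_path_iff:
  "nonzero_path p A P \<longleftrightarrow> (\<exists>\<sigma>\<in>nonzero_perms. P = (\<lambda>c. (\<sigma> c, c)) ` {..<p})"
proof
  assume "nonzero_path p A P"
  then obtain f where f: "f ` {..<p} \<subseteq> {..<p}" "inj_on f {..<p}"
    and P: "P = (\<lambda>c. (f c, c)) ` {..<p}" and nz: "\<forall>(r, c)\<in>P. A $$ (r, c) \<noteq> 0"
    unfolding nonzero_path_def is_path_def by blast
  \<comment> \<open>\<open>f\<close> is arbitrary outside the columns of \<open>A\<close>, where a permutation has to be the identity.\<close>
  define \<sigma> where "\<sigma> c = (if c < p then f c else c)" for c
  have "bij_betw f {..<p} {..<p}"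
    using f endo_inj_surj[of "{..<p}" f] by (simp add: bij_betw_def)
  then have "bij_betw \<sigma> {..<p} {..<p}"
    by (subst bij_betw_cong[of _ _ f]) (simp_all add: \<sigma>_def)
  then have "bij_betw \<sigma> {0..<p} {0..<p}" by (simp add: atLeast0LessThan)
  then have "\<sigma> permutes {0..<p}"
    by (rule bij_imp_permutes) (simp add: \<sigma>_def)
  moreover have "P = (\<lambda>c. (\<sigma> c, c)) ` {..<p}"
    unfolding P by (auto simp: \<sigma>_def)
  ultimately show "\<exists>\<sigma>\<in>nonzero_perms. P = (\<lambda>c. (\<sigma> c, c)) ` {..<p}"
    using nz by (auto simp: nonzero_perms_def intro!: bexI[of _ \<sigma>])
next
  assume "\<exists>\<sigma>\<in>nonzero_perms. P = (\<lambda>c. (\<sigma> c, c)) ` {..<p}"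
  then obtain \<sigma> where \<sigma>: "\<sigma> \<in> nonzero_perms" and P: "P = (\<lambda>c. (\<sigma> c, c)) ` {..<p}" by blast
  have "inj_on \<sigma> {..<p}"
    using permutes_inj[OF nonzero_permsD(1)[OF \<sigma>]] by (rule inj_on_subset) simp
  moreover have "\<sigma> ` {..<p} \<subseteq> {..<p}" using nonzero_permsD(3)[OF \<sigma>] by auto
  ultimately show "nonzero_path p A P"
    unfolding nonzero_path_def is_path_def using P nonzero_permsD(2)[OF \<sigma>] by auto
qed

end

section \<open>Minors of the matrix of a permutation\<close>

text \<open>The bounds on \<open>v\<close> make the truncated subtractions in \<open>Z_entry\<close> exact, so that its
  conditions can be read with rows counted from the top: the \<open>1\<close> of column \<open>c\<close> is in row
  \<open>v (c + 1) - 1\<close>.\<close>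
lemma Z_mat_entry:
  assumes v: "v permutes {1..n}" and r: "r < n" and c: "c < n"
  shows "(Z_mat n v $$ (r, c) :: (nat \<times> nat, 'a::comm_ring_1) mpolynomial)
    = (if r + 1 = v (c + 1) then 1
       else if r + 1 < v (c + 1) then 0
       else if \<exists>d<c. r + 1 = v (d + 1) then 0
       else indet (n - r, c + 1))"
proof -
  have range: "1 \<le> v (d + 1) \<and> v (d + 1) \<le> n" if "d < n" for d
    using permutes_in_image[OF v, of "d + 1"] that by simp
  have eq: "n - r = n - v (d + 1) + 1 \<longleftrightarrow> r + 1 = v (d + 1)" if "d < n" for d
    using range[OF that] r by linarith
  have less: "n - v (c + 1) + 1 < n - r \<longleftrightarrow> r + 1 < v (c + 1)"
    using range[OF c] r by linarith
  have "(\<exists>j\<in>{1..<c + 1}. n - r = n - v j + 1) \<longleftrightarrow> (\<exists>d<c. n - r = n - v (d + 1) + 1)"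
  proof
    assume "\<exists>j\<in>{1..<c + 1}. n - r = n - v j + 1"
    then obtain j where "j \<in> {1..<c + 1}" "n - r = n - v j + 1" by blast
    then show "\<exists>d<c. n - r = n - v (d + 1) + 1"
      by (intro exI[of _ "j - 1"]) auto
  next
    assume "\<exists>d<c. n - r = n - v (d + 1) + 1"
    then obtain d where "d < c" "n - r = n - v (d + 1) + 1" by blast
    then show "\<exists>j\<in>{1..<c + 1}. n - r = n - v j + 1"
      by (intro bexI[of _ "d + 1"]) auto
  qed
  also have "\<dots> \<longleftrightarrow> (\<exists>d<c. r + 1 = v (d + 1))"
    using eq c by (meson less_trans)
  finally have ex: "(\<exists>j\<in>{1..<c + 1}. n - r = n - v j + 1) \<longleftrightarrow> (\<exists>d<c. r + 1 = v (d + 1))" .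
  show ?thesis
    unfolding Z_mat_def using r c
    by (simp only: index_mat prod.case Z_entry_def eq[OF c] less ex)
qed

lemma Z_mat_eq_one_iff:
  assumes "v permutes {1..n}" "r < n" "c < n"
  shows "Z_mat n v $$ (r, c) = (1 :: (nat \<times> nat, 'a::comm_ring_1) mpolynomial)
    \<longleftrightarrow> r + 1 = v (c + 1)"
  by (simp add: Z_mat_entry[OF assms] indet_neq)

lemma Z_mat_eq_zero_iff:
  assumes "v permutes {1..n}" "r < n" "c < n"
  shows "Z_mat n v $$ (r, c) = (0 :: (nat \<times> nat, 'a::comm_ring_1) mpolynomial)
    \<longleftrightarrow> r + 1 < v (c + 1) \<or> (\<exists>d<c. r + 1 = v (d + 1))"
proof -
  \<comment> \<open>The case of an entry \<open>1\<close> comes first in \<open>Z_mat_entry\<close>, but it excludes both reasons for a zero.\<close>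
  have "v (d + 1) \<noteq> v (c + 1)" if "d < c" for d
    using permutes_inj[OF assms(1)] that by (auto dest: injD)
  then have not_one_if_left_one: "r + 1 \<noteq> v (c + 1)" if "\<exists>d<c. r + 1 = v (d + 1)"
    using that by metis
  have if_zero_iff: "(if P then 1 else if Q then 0 else if R then 0 else z)
      = (0 :: (nat \<times> nat, 'a) mpolynomial) \<longleftrightarrow> Q \<or> R"
    if "Q \<Longrightarrow> \<not> P" "R \<Longrightarrow> \<not> P" "z \<noteq> 0" for P Q R z
    using that by auto
  show ?thesis
    unfolding Z_mat_entry[OF assms]
    by (rule if_zero_iff[OF _ not_one_if_left_one indet_neq(1)]) simp_all
qed

text \<open>Row \<open>s\<close> is zero to the right of its \<open>1\<close>, so \<open>d < c\<close> and the \<open>1\<close> of column \<open>d\<close> lies above row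
  \<open>s\<close>, hence above row \<open>r\<close>. A \<open>1\<close> in row \<open>r\<close> to the left of column \<open>d\<close> would also be to the left of
  column \<open>c\<close> and make \<open>(r, c)\<close> zero.\<close>
lemma Z_mat_exchange:
  fixes v :: "nat \<Rightarrow> nat" and n :: nat
  defines "Z \<equiv> (Z_mat n v :: (nat \<times> nat, 'a::comm_ring_1) mpolynomial mat)"
  assumes v: "v permutes {1..n}" and bounds: "r < n" "s < n" "c < n" "d < n"
    and "d \<noteq> c" "s < r" "Z $$ (s, c) = 1" "Z $$ (r, c) \<noteq> 0" "Z $$ (s, d) \<noteq> 0"
  shows "Z $$ (s, d) \<noteq> 1 \<and> Z $$ (r, d) \<notin> {0, 1}"
proof -
  note one = Z_mat_eq_one_iff[OF v, where 'a = 'a, folded Z_def]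
    and zero = Z_mat_eq_zero_iff[OF v, where 'a = 'a, folded Z_def]
  have s: "s + 1 = v (c + 1)" using assms one by blast
  have "d < c"
    using \<open>Z $$ (s, d) \<noteq> 0\<close> \<open>d \<noteq> c\<close> s zero[OF bounds(2,4)] by (meson linorder_neqE_nat)
  have sd: "v (d + 1) \<noteq> s + 1"
    using permutes_inj[OF v] \<open>d \<noteq> c\<close> s by (auto dest: injD)
  moreover have "v (d + 1) \<le> s + 1"
    using \<open>Z $$ (s, d) \<noteq> 0\<close> zero[OF bounds(2,4)] by simp
  ultimately have "v (d + 1) < r + 1" using \<open>s < r\<close> by simp
  moreover have "\<not> (\<exists>e<d. r + 1 = v (e + 1))"
    using \<open>Z $$ (r, c) \<noteq> 0\<close> zero[OF bounds(1,3)] \<open>d < c\<close> by (meson less_trans)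
  ultimately show ?thesis
    using sd one[OF bounds(2,4)] one[OF bounds(1,4)] zero[OF bounds(1,4)] by auto
qed

text \<open>The rows and columns of a minor are selected in increasing order, so above, below, left
  and right mean the same in the minor as in \<open>Z\<^sup>(\<^sup>v\<^sup>)\<close>.\<close>
lemma minor_staircase:
  fixes A :: "(nat \<times> nat, 'a::comm_ring_1) mpolynomial mat"
  assumes v: "v permutes {1..n}" and A: "is_minor p A (Z_mat n v)"
  obtains x where "staircase_matrix A p x" "x ` ({..<p} \<times> {..<p}) \<subseteq> {1..n} \<times> {1..n}"
proof -
  let ?Z = "Z_mat n v :: (nat \<times> nat, 'a) mpolynomial mat"
  have dimZ: "dim_row ?Z = n" "dim_col ?Z = n" by (simp_all add: Z_mat_def)
  from A obtain I J where I: "I \<subseteq> {..<n}" "card I = p" and J: "J \<subseteq> {..<n}" "card J = p"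
    and A_def: "A = submatrix ?Z I J"
    unfolding is_minor_def dimZ by blast
  have sel: "{i. i < n \<and> i \<in> I} = I" "{j. j < n \<and> j \<in> J} = J" using I(1) J(1) by auto
  define \<rho> \<kappa> where "\<rho> = pick I" and "\<kappa> = pick J"
  have mono: "a < b \<Longrightarrow> b < p \<Longrightarrow> \<rho> a < \<rho> b" "a < b \<Longrightarrow> b < p \<Longrightarrow> \<kappa> a < \<kappa> b" for a b
    using I(2) J(2) pick_mono_le unfolding \<rho>_def \<kappa>_def by auto
  have inj: "\<rho> a = \<rho> b \<longleftrightarrow> a = b" "\<kappa> a = \<kappa> b \<longleftrightarrow> a = b" if "a < p" "b < p" for a b
    using mono that by (metis linorder_neqE_nat less_irrefl)+
  have bnd: "\<rho> a < n" "\<kappa> a < n" if "a < p" for a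
    using that I J pick_in_set_le[of a I] pick_in_set_le[of a J] unfolding \<rho>_def \<kappa>_def by auto
  have A_entry: "A $$ (r, c) = ?Z $$ (\<rho> r, \<kappa> c)" if "r < p" "c < p" for r c
    using that I(2) J(2) unfolding A_def \<rho>_def \<kappa>_def
    by (intro submatrix_index) (simp_all add: dimZ sel)
  define x where "x = (\<lambda>(r, c). (n - \<rho> r, \<kappa> c + 1))"
  have "staircase_matrix A p x"
  proof
    show "A \<in> carrier_mat p p"
      unfolding A_def by (rule carrier_matI) (simp_all add: dim_submatrix dimZ sel I J)
    show "A $$ (r, c) \<in> {0, 1, indet (x (r, c))}" if "r < p" "c < p" for r c
      by (simp add: A_entry[OF that] Z_mat_entry[OF v bnd(1)[OF that(1)] bnd(2)[OF that(2)]] x_def)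
    show "inj_on x ({..<p} \<times> {..<p})"
    proof (rule inj_onI, clarify)
      fix r c r' c' assume *: "r < p" "c < p" "r' < p" "c' < p" "x (r, c) = x (r', c')"
      then have "\<rho> r = \<rho> r'" "\<kappa> c = \<kappa> c'" using bnd(1)[of r] bnd(1)[of r'] by (auto simp: x_def)
      with * show "r = r' \<and> c = c'" using inj by blast
    qed
    show "A $$ (k, c) = 0" if "s < p" "c < p" "A $$ (s, c) = 1" "k < s" for k s c
    proof -
      have "\<rho> s + 1 = v (\<kappa> c + 1)"
        using that A_entry Z_mat_eq_one_iff[OF v bnd(1)[of s] bnd(2)[of c], where 'a = 'a] by simp
      then show ?thesis
        using that mono(1)[of k s] A_entry
          Z_mat_eq_zero_iff[OF v bnd(1)[of k] bnd(2)[of c], where 'a = 'a] by simp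
    qed
    show "A $$ (s, d) \<noteq> 1 \<and> A $$ (r, d) \<notin> {0, 1}"
      if "r < p" "s < p" "c < p" "d < p" "d \<noteq> c" "s < r"
        "A $$ (s, c) = 1" "A $$ (r, c) \<noteq> 0" "A $$ (s, d) \<noteq> 0" for r s c d
    proof -
      note e = A_entry[OF \<open>s < p\<close> \<open>c < p\<close>] A_entry[OF \<open>r < p\<close> \<open>c < p\<close>]
        A_entry[OF \<open>s < p\<close> \<open>d < p\<close>] A_entry[OF \<open>r < p\<close> \<open>d < p\<close>]
      have "\<rho> s < \<rho> r" "\<kappa> d \<noteq> \<kappa> c" using that mono(1) inj(2) by auto
      then show ?thesis
        using Z_mat_exchange[OF v bnd(1)[OF \<open>r < p\<close>] bnd(1)[OF \<open>s < p\<close>] bnd(2)[OF \<open>c < p\<close>]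
            bnd(2)[OF \<open>d < p\<close>], where 'a = 'a] that(7-9)
        unfolding e by blast
    qed
  qed
  moreover have "x ` ({..<p} \<times> {..<p}) \<subseteq> {1..n} \<times> {1..n}"
    using bnd by (force simp: x_def)
  ultimately show ?thesis using that by blast
qed

theorem theorem6p1p4:
  fixes n p :: nat and v :: "nat \<Rightarrow> nat"
    and A :: "(nat \<times> nat, 'a::comm_ring_1) mpolynomial mat"
  assumes "v permutes {1..n}"
    and "p \<ge> 2"
    and "is_minor p A (Z_mat n v)"
  shows "inhomogeneous (det A) \<longleftrightarrow>
    (\<exists>c<p. \<exists>r. column_with_variable_below_one n p A c r \<and>
               (\<exists>P. nonzero_path p A P \<and> (r, c) \<in> P))"
proof -
  obtain x where "staircase_matrix A p x" and x: "x ` ({..<p} \<times> {..<p}) \<subseteq> {1..n} \<times> {1..n}"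
    using minor_staircase[OF assms(1,3)] .
  then interpret staircase_matrix A p x by simp
  show ?thesis
  proof
    assume "inhomogeneous (det A)"
    then obtain \<sigma> c s where \<sigma>: "\<sigma> \<in> nonzero_perms" and c: "c < p" and s: "s < \<sigma> c"
      and one: "A $$ (s, c) = 1"
      unfolding inhomogeneous_det_iff by blast
    note r = nonzero_permsD(3)[OF \<sigma> c]
    have "A $$ (\<sigma> c, c) \<noteq> 1"
      using one_unique_in_column[OF r _ c _ one] s r by auto
    then have "A $$ (\<sigma> c, c) = indet (x (\<sigma> c, c))"
      using entry[OF r c] nonzero_permsD(2)[OF \<sigma> c] by auto
    moreover have "x (\<sigma> c, c) \<in> {1..n} \<times> {1..n}" using x r c by blast
    ultimately have
      "A $$ (\<sigma> c, c) \<in> {indet (i, j) | i j. 1 \<le> i \<and> i \<le> n \<and> 1 \<le> j \<and> j \<le> n}"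
      by (cases "x (\<sigma> c, c)") auto
    then have "column_with_variable_below_one n p A c (\<sigma> c)"
      unfolding column_with_variable_below_one_def
      using s r one zero_above_one[OF _ c one] by (intro exI[of _ s]) auto
    moreover have "nonzero_path p A ((\<lambda>c. (\<sigma> c, c)) ` {..<p})"
      using \<sigma> nonzero_path_iff by blast
    ultimately show "\<exists>c<p. \<exists>r. column_with_variable_below_one n p A c r \<and>
        (\<exists>P. nonzero_path p A P \<and> (r, c) \<in> P)"
      using c by blast
  next
    assume "\<exists>c<p. \<exists>r. column_with_variable_below_one n p A c r \<and>
        (\<exists>P. nonzero_path p A P \<and> (r, c) \<in> P)"
    then obtain c r P where c: "c < p" and col: "column_with_variable_below_one n p A c r"
      and P: "nonzero_path p A P" "(r, c) \<in> P" by blast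
    from col obtain s where "s < r" "A $$ (s, c) = 1"
      unfolding column_with_variable_below_one_def by blast
    moreover from P obtain \<sigma> where "\<sigma> \<in> nonzero_perms" "r = \<sigma> c"
      unfolding nonzero_path_iff by blast
    ultimately show "inhomogeneous (det A)"
      unfolding inhomogeneous_det_iff using c by blast
  qed
qed

end
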